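(* Let $\mathcal{K}\subset \mathbb{N}_{\min}^n$ be a finitely generated semimodule. Then, for all matrices $A\in \mathbb{N}_{\min}^{n\times n}$ and $B\in \mathbb{N}_{\min}^{n\times q}$, the maximal (geometrically) $(A,B)$-invariant semimodule $\mathcal{K}^*$ contained in $\mathcal{K}$ is given by $\mathcal{K}^*=\mathcal{X}_{\omega}=\bigcap_{r\geq 1}\mathcal{X}_r$, where the sequence of semimodules $\{\mathcal{X}_r\}_{r\geq 1}$ is defined by $\mathcal{X}_1=\mathcal{K}$ and $\mathcal{X}_{r+1}=\varphi(\mathcal{X}_r)$ for all $r\geq 1$.
   Context: $\mathbb{N}_{\min}$ is the tropical semiring $(\mathbb{N}\cup\{+\infty\},\oplus,\otimes)$ with $0\in\mathbb{N}$, $\oplus=\min$ and $\otimes=+$; its zero element is $+\infty$ and its unit is $0$. Matrix-vector products and sums are taken in this semiring: $(Ax)_i=\min_j(A_{ij}+x_j)$, $(x\oplus y)_i=\min(x_i,y_i)$, and scalars act by $(\lambda x)_i=\lambda+x_i$. A semimodule $\mathcal{X}\subset\mathbb{N}_{\min}^n$ means a subsemimodule: a subset containing the zero vector $(+\infty,\ldots,+\infty)^T$ and closed under $(x,y)\mapsto \lambda x\oplus\mu y$ for all $\lambda,\mu\in\mathbb{N}_{\min}$. It is finitely generated if it consists of all finite $\oplus$-linear combinations of finitely many of its elements. A semimodule $\mathcal{X}\subset\mathbb{N}_{\min}^n$ is (geometrically) $(A,B)$-invariant if for all $x\in\mathcal{X}$ there exists $u\in\mathbb{N}_{\min}^q$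 such that $Ax\oplus Bu\in\mathcal{X}$. $\mathcal{K}^*$ denotes the maximal (i.e. largest for inclusion) such semimodule contained in $\mathcal{K}$. The map $\varphi$ on subsemimodules of $\mathbb{N}_{\min}^n$ is $\varphi(\mathcal{X})=\mathcal{X}\cap A^{-1}(\mathcal{X}\ominus\mathcal{B})$, where $\mathcal{B}=\operatorname{Im}B$ is the subsemimodule generated by the columns of $B$, $A^{-1}(\mathcal{Y})=\{u\mid Au\in\mathcal{Y}\}$, and $\mathcal{Z}\ominus\mathcal{Y}=\{u\mid \exists y\in\mathcal{Y},\ u\oplus y\in\mathcal{Z}\}$. *)

theory Defs
  imports "HOL-Analysis.Analysis" "HOL-Library.Extended_Nat"
begin

text \<open>
  The tropical semiring is a copy of \<^typ>\<open>enat\<close>, so that its addition (minimum), multiplication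
  (sum), zero (infinity) and one (\<open>0\<close>) can be the class operations. The library's vector addition,
  scaling \<open>*s\<close> and matrix-vector product \<open>*v\<close> are then the tropical ones.
\<close>

datatype nmin = Nmin (enat_of: enat)

instantiation nmin :: comm_semiring_1
begin

definition zero_nmin :: nmin where "0 = Nmin \<infinity>"
definition one_nmin :: nmin where "1 = Nmin 0"
definition plus_nmin :: "nmin \<Rightarrow> nmin \<Rightarrow> nmin"
  where "a + b = Nmin (min (enat_of a) (enat_of b))"
definition times_nmin :: "nmin \<Rightarrow> nmin \<Rightarrow> nmin"
  where "a * b = Nmin (enat_of a + enat_of b)"

instance
proof
  fix a b c :: nmin
  show "a * b * c = a * (b * c)"
    by (simp add: times_nmin_def add.assoc)
  show "a * b = b * a"
    by (simp add: times_nmin_def add.commute)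
  show "1 * a = a"
    by (simp add: times_nmin_def one_nmin_def)
  show "a + b + c = a + (b + c)"
    by (simp add: plus_nmin_def min.assoc)
  show "a + b = b + a"
    by (simp add: plus_nmin_def min.commute)
  show "0 + a = a"
    by (simp add: plus_nmin_def zero_nmin_def min_def)
  show "(a + b) * c = a * c + b * c"
    by (auto simp: plus_nmin_def times_nmin_def min_def intro: antisym add_right_mono)
  show "0 * a = 0"
    by (simp add: times_nmin_def zero_nmin_def)
  show "a * 0 = 0"
    by (simp add: times_nmin_def zero_nmin_def)
  show "(0::nmin) \<noteq> 1"
    by (simp add: zero_nmin_def one_nmin_def)
qed

end

lemma matrix_vector_mult_nmin:
  fixes A :: "nmin^'n^'m"
  shows "enat_of ((A *v x) $ i) = (MIN j. enat_of (A $ i $ j) + enat_of (x $ j))"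
proof -
  have "finite S \<Longrightarrow> S \<noteq> {} \<Longrightarrow> enat_of (sum f S) = Min ((\<lambda>j. enat_of (f j)) ` S)"
    for S :: "'n set" and f
    by (induction S rule: finite_ne_induct) (simp_all add: plus_nmin_def zero_nmin_def)
  then show ?thesis
    by (simp add: matrix_vector_mult_def times_nmin_def)
qed

definition subsemimodule :: "(nmin^'n) set \<Rightarrow> bool" where
  "subsemimodule X \<longleftrightarrow> 0 \<in> X \<and> (\<forall>x\<in>X. \<forall>y\<in>X. \<forall>l m. l *s x + m *s y \<in> X)"

definition semimodule_span :: "(nmin^'n) set \<Rightarrow> (nmin^'n) set" where
  "semimodule_span G = {\<Sum>g\<in>S. c g *s g | S c. finite S \<and> S \<subseteq> G}"

definition finitely_generated :: "(nmin^'n) set \<Rightarrow> bool" where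
  "finitely_generated X \<longleftrightarrow> (\<exists>G. finite G \<and> G \<subseteq> X \<and> X = semimodule_span G)"

definition matrix_image :: "nmin^'q^'n \<Rightarrow> (nmin^'n) set" where
  "matrix_image B = semimodule_span (columns B)"

lemma subsemimodule_sum:
  assumes "subsemimodule X" "\<And>i. i \<in> I \<Longrightarrow> f i \<in> X"
  shows "(\<Sum>i\<in>I. c i *s f i) \<in> X"
  using assms(2)
proof (induction I rule: infinite_finite_induct)
  case (insert i I)
  then have "c i *s f i + 1 *s (\<Sum>i\<in>I. c i *s f i) \<in> X"
    using assms(1) unfolding subsemimodule_def by blast
  with insert show ?case by simp
qed (use assms(1) in \<open>auto simp: subsemimodule_def\<close>)

lemma subsemimodule_span: "subsemimodule (semimodule_span G)"
  unfolding subsemimodule_def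
proof (intro conjI ballI allI)
  show "0 \<in> semimodule_span G"
    unfolding semimodule_span_def by (intro CollectI exI[of _ "{}"]) auto
next
  fix x y l m assume "x \<in> semimodule_span G" "y \<in> semimodule_span G"
  then obtain S c T d where
    S: "finite S" "S \<subseteq> G" "x = (\<Sum>g\<in>S. c g *s g)" and
    T: "finite T" "T \<subseteq> G" "y = (\<Sum>g\<in>T. d g *s g)"
    unfolding semimodule_span_def by blast
  define c' d' where "c' g = (if g \<in> S then c g else 0)" and "d' g = (if g \<in> T then d g else 0)"
    for g
  have "x = (\<Sum>g\<in>S \<union> T. c' g *s g)" "y = (\<Sum>g\<in>S \<union> T. d' g *s g)"
    unfolding S(3) T(3) using S(1) T(1)
    by (auto intro!: sum.mono_neutral_cong_left simp: c'_def d'_def)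
  then have "l *s x + m *s y = (\<Sum>g\<in>S \<union> T. (l * c' g + m * d' g) *s g)"
    by (simp add: vec_eq_iff sum_distrib_left sum.distrib algebra_simps)
  moreover have "finite (S \<union> T)" "S \<union> T \<subseteq> G" using S T by auto
  ultimately show "l *s x + m *s y \<in> semimodule_span G"
    unfolding semimodule_span_def
    by (intro CollectI exI[of _ "S \<union> T"] exI[of _ "\<lambda>g. l * c' g + m * d' g"]) auto
qed

lemma semimodule_span_base: "g \<in> G \<Longrightarrow> g \<in> semimodule_span G"
  unfolding semimodule_span_def
  by (intro CollectI exI[of _ "{g}"] exI[of _ "\<lambda>_. 1"]) auto

lemma semimodule_span_hull: "semimodule_span G = subsemimodule hull G"
proof (rule hull_unique[symmetric])
  fix X assume "G \<subseteq> X" "subsemimodule X"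
  then show "semimodule_span G \<subseteq> X"
    unfolding semimodule_span_def by (auto intro!: subsemimodule_sum)
qed (auto intro: subsemimodule_span semimodule_span_base)

lemma matrix_vector_mult_combination:
  fixes A :: "nmin^'n^'m" and x y :: "nmin^'n"
  shows "A *v (l *s x + m *s y) = l *s (A *v x) + m *s (A *v y)"
  by (simp add: vec_eq_iff matrix_vector_mult_def sum_distrib_left sum.distrib algebra_simps)

lemma matrix_image_eq_range: "matrix_image B = range (\<lambda>u. B *v u)"
  unfolding matrix_image_def semimodule_span_hull
proof (rule hull_unique)
  show "columns B \<subseteq> range (\<lambda>u. B *v u)"
  proof
    fix v assume "v \<in> columns B"
    then obtain j where v: "v = column j B" by (auto simp: columns_def)
    have "v = B *v axis j 1"
      unfolding v by (simp add: vec_eq_iff matrix_vector_mult_def column_def axis_def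
          if_distrib cong: if_cong)
    then show "v \<in> range (\<lambda>u. B *v u)" by blast
  qed
  have "B *v 0 = 0" by (simp add: vec_eq_iff matrix_vector_mult_def)
  then show "subsemimodule (range (\<lambda>u. B *v u))"
    unfolding subsemimodule_def
    by (auto simp: matrix_vector_mult_combination[symmetric] intro: range_eqI[of _ _ 0])
next
  fix X assume X: "columns B \<subseteq> X" "subsemimodule X"
  have "B *v u = (\<Sum>j\<in>UNIV. u $ j *s column j B)" for u
    by (simp add: vec_eq_iff matrix_vector_mult_def column_def mult.commute)
  moreover have "(\<Sum>j\<in>UNIV. u $ j *s column j B) \<in> X" for u
    using X by (intro subsemimodule_sum) (auto simp: columns_def)
  ultimately show "range (\<lambda>u. B *v u) \<subseteq> X" by auto
qed

definition semimodule_ominus :: "(nmin^'n) set \<Rightarrow> (nmin^'n) set \<Rightarrow> (nmin^'n) set"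
    (infixl "\<ominus>" 65) where
  "Z \<ominus> Y = {u. \<exists>y\<in>Y. u + y \<in> Z}"

definition phi :: "nmin^'n^'n \<Rightarrow> nmin^'q^'n \<Rightarrow> (nmin^'n) set \<Rightarrow> (nmin^'n) set" where
  "phi A B X = X \<inter> (\<lambda>u. A *v u) -` (X \<ominus> matrix_image B)"

lemma subsemimodule_phi:
  assumes "subsemimodule X"
  shows "subsemimodule (phi A B X)"
  unfolding subsemimodule_def
proof (intro conjI ballI allI)
  have "subsemimodule (matrix_image B)"
    unfolding matrix_image_def by (rule subsemimodule_span)
  note sub = assms this
  have "A *v 0 = 0" by (simp add: vec_eq_iff matrix_vector_mult_def)
  then show "0 \<in> phi A B X"
    using sub by (auto simp: phi_def semimodule_ominus_def subsemimodule_def intro: bexI[of _ 0])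
  fix x y l m assume "x \<in> phi A B X" "y \<in> phi A B X"
  then obtain v w where xy: "x \<in> X" "y \<in> X" and
    vw: "v \<in> matrix_image B" "w \<in> matrix_image B" "A *v x + v \<in> X" "A *v y + w \<in> X"
    by (auto simp: phi_def semimodule_ominus_def)
  have "A *v (l *s x + m *s y) + (l *s v + m *s w) = l *s (A *v x + v) + m *s (A *v y + w)"
    unfolding matrix_vector_mult_combination by (simp add: vec_eq_iff algebra_simps)
  also have "\<dots> \<in> X" using sub vw unfolding subsemimodule_def by blast
  finally have "A *v (l *s x + m *s y) \<in> X \<ominus> matrix_image B"
    using sub vw by (auto simp: semimodule_ominus_def subsemimodule_def)
  moreover have "l *s x + m *s y \<in> X" using sub xy by (simp add: subsemimodule_def)
  ultimately show "l *s x + m *s y \<in> phi A B X" by (simp add: phi_def)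
qed

definition invariant_semimodule :: "nmin^'n^'n \<Rightarrow> nmin^'q^'n \<Rightarrow> (nmin^'n) set \<Rightarrow> bool" where
  "invariant_semimodule A B X \<longleftrightarrow>
     subsemimodule X \<and> (\<forall>x\<in>X. \<exists>u. A *v x + B *v u \<in> X)"

text \<open>Maximal means greatest for inclusion, hence at most one \<open>M\<close> qualifies.\<close>

definition maximal_invariant_semimodule ::
    "nmin^'n^'n \<Rightarrow> nmin^'q^'n \<Rightarrow> (nmin^'n) set \<Rightarrow> (nmin^'n) set \<Rightarrow> bool" where
  "maximal_invariant_semimodule A B K M \<longleftrightarrow>
     invariant_semimodule A B M \<and> M \<subseteq> K \<and>
     (\<forall>X. invariant_semimodule A B X \<and> X \<subseteq> K \<longrightarrow> X \<subseteq> M)"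

end

theory Submission
  imports Defs
begin

text \<open>
  The order topology of \<open>\<nat> \<union> {\<infinity>}\<close> is compact, and both tropical operations are continuous for it.
  Hence a finitely generated semimodule is compact, as a continuous image of a power of the
  semiring, and \<open>\<phi>\<close> preserves closedness, since it is a projection along the compact space of
  controls. For a state in all \<open>\<X>\<^sub>r\<close> the sets of controls leading into \<open>\<X>\<^sub>r\<close> form a decreasing
  sequence of nonempty compact sets, so one control works for all \<open>r\<close> simultaneously.
\<close>

section \<open>Order topology and continuity of the tropical operations\<close>

instantiation nmin :: t2_space
begin

text \<open>The topology of \<open>enat\<close> is transported along the bijection
  \<open>Nmin\<close>, which thereby becomes a homeomorphism.\<close>

definition open_nmin :: "nmin set \<Rightarrow> bool" where
  "open_nmin U \<longleftrightarrow> open (Nmin -` U)"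

instance
proof
  show "open (UNIV :: nmin set)"
    by (simp add: open_nmin_def)
  show "open (S \<inter> T)" if "open S" "open T" for S T :: "nmin set"
    using that by (auto simp: open_nmin_def)
  show "open (\<Union>C)" if "\<forall>S\<in>C. open S" for C :: "nmin set set"
    using that by (auto simp: open_nmin_def vimage_Union)
  fix x y :: nmin assume "x \<noteq> y"
  then have "enat_of x \<noteq> enat_of y"
    by (cases x; cases y) simp
  then obtain U V where UV: "open U" "open V" "enat_of x \<in> U" "enat_of y \<in> V" "U \<inter> V = {}"
    using hausdorff by metis
  have "Nmin -` enat_of -` S = S" for S
    by auto
  with UV show "\<exists>U V. open U \<and> open V \<and> x \<in> U \<and> y \<in> V \<and> U \<inter> V = {}"
    by (intro exI[of _ "enat_of -` U"] exI[of _ "enat_of -` V"]) (auto simp: open_nmin_def)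
qed

end

lemma continuous_on_Nmin: "continuous_on UNIV Nmin"
  by (auto simp: continuous_on_open_vimage open_nmin_def)

lemma continuous_on_enat_of: "continuous_on UNIV enat_of"
proof -
  have "Nmin -` enat_of -` S = S" for S
    by auto
  then show ?thesis
    by (auto simp: continuous_on_open_vimage open_nmin_def)
qed

lemma compact_UNIV_nmin: "compact (UNIV :: nmin set)"
proof -
  have "compact (range Nmin)"
    by (intro compact_continuous_image continuous_on_Nmin compact_UNIV)
  also have "range Nmin = UNIV"
    by (metis nmin.collapse surjI)
  finally show ?thesis .
qed

text \<open>Tropical addition is continuous because \<open>min\<close> is continuous in an order
  topology. The instance makes finite tropical sums accessible to
  \<open>continuous_intros\<close>.\<close>

instance nmin :: topological_comm_monoid_add
proof
  fix a b :: nmin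
  have "continuous_on UNIV (\<lambda>x. Nmin (min (enat_of (fst x)) (enat_of (snd x))))"
    by (intro continuous_on_compose2[OF continuous_on_Nmin] continuous_on_min
        continuous_on_compose2[OF continuous_on_enat_of] continuous_intros) auto
  then have "isCont (\<lambda>x. fst x + snd x) (a, b)"
    by (simp add: continuous_on_eq_continuous_at plus_nmin_def)
  \<comment> \<open>The class axiom speaks of full neighbourhood filters, continuity of punctured
    ones; they agree here because the limit is the value at the point.\<close>
  then have "((\<lambda>x. fst x + snd x) \<longlongrightarrow> fst (a, b) + snd (a, b)) (nhds (a, b))"
    unfolding isCont_def by (rule tendsto_at_iff_tendsto_nhds[THEN iffD1])
  then show "LIM x (nhds a \<times>\<^sub>F nhds b). fst x + snd x :> nhds (a + b)"
    by (simp add: nhds_prod)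
qed

text \<open>Addition on \<open>enat\<close> is jointly continuous even at infinity, since there are
  no negative values to cancel against it.\<close>

instance nmin :: topological_semigroup_mult
proof
  fix a b :: nmin
  have "continuous_on UNIV (\<lambda>x. Nmin (enat_of (fst x) + enat_of (snd x)))"
    by (intro continuous_on_compose2[OF continuous_on_Nmin] continuous_on_add
        continuous_on_compose2[OF continuous_on_enat_of] continuous_intros) auto
  then have "isCont (\<lambda>x. fst x * snd x) (a, b)"
    by (simp add: continuous_on_eq_continuous_at times_nmin_def)
  then have "((\<lambda>x. fst x * snd x) \<longlongrightarrow> fst (a, b) * snd (a, b)) (nhds (a, b))"
    unfolding isCont_def by (rule tendsto_at_iff_tendsto_nhds[THEN iffD1])
  then show "LIM x (nhds a \<times>\<^sub>F nhds b). fst x * snd x :> nhds (a * b)"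
    by (simp add: nhds_prod)
qed

section \<open>Compactness and closedness in powers of the semiring\<close>

lemma compact_imp_closed_vec:
  fixes S :: "('a::t2_space ^ 'n) set"
  assumes "compact S"
  shows "closed S"
proof -
  have cont: "continuous_on UNIV (vec_nth :: 'a^'n \<Rightarrow> _)"
    by (intro continuous_on_coordinatewise_then_product continuous_intros)
  have "compact (vec_nth ` S)"
    using assms by (intro compact_continuous_image continuous_on_subset[OF cont]) auto
  moreover have "Hausdorff_space (euclidean :: 'a topology)"
    unfolding Hausdorff_space_def disjnt_def by (simp, metis hausdorff)
  then have "Hausdorff_space (euclidean :: ('n \<Rightarrow> 'a) topology)"
    unfolding euclidean_product_topology[symmetric]
    by (simp add: Hausdorff_space_product_topology)
  ultimately have "closed (vec_nth ` S)"
    using compactin_imp_closedin[of euclidean "vec_nth ` S"] by simp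
  \<comment> \<open>Closedness in the Hausdorff function space pulls back along the continuous map
    \<open>vec_nth\<close>; injectivity then recovers \<open>S\<close> itself.\<close>
  then have "closed (vec_nth -` (vec_nth ` S))"
    by (intro closed_vimage cont)
  also have "vec_nth -` (vec_nth ` S) = S"
    by (auto simp: vec_nth_inject)
  finally show ?thesis .
qed

text \<open>Tychonoff's theorem. The index type may be infinite: besides coordinates of vectors it
  will be the type of all vectors, indexing coefficient functions.\<close>

lemma compact_UNIV_fun:
  assumes "compact (UNIV :: 'b::topological_space set)"
  shows "compact (UNIV :: ('a \<Rightarrow> 'b) set)"
proof -
  have "compact_space (euclidean :: 'b topology)"
    using assms by (simp add: compact_space_def)
  then have "compact_space (product_topology (\<lambda>_::'a. euclidean :: 'b topology) UNIV)"
    by (simp add: compact_space_product_topology)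
  then show ?thesis
    by (simp add: euclidean_product_topology compact_space_def)
qed

lemma compact_UNIV_vec:
  assumes "compact (UNIV :: 'a::topological_space set)"
  shows "compact (UNIV :: ('a^'n) set)"
proof -
  have "compact (range (vec_lambda :: ('n \<Rightarrow> 'a) \<Rightarrow> _))"
    by (intro compact_continuous_image compact_UNIV_fun assms
        continuous_on_vec_lambda[where f = "\<lambda>i x. x i"] continuous_on_product_coordinates)
  also have "range (vec_lambda :: ('n \<Rightarrow> 'a) \<Rightarrow> _) = UNIV"
    by (metis vec_nth_inverse surjI)
  finally show ?thesis .
qed

section \<open>Closedness of finitely generated semimodules and of their images under
  \<open>phi\<close>\<close>

lemma continuous_on_matrix_vector_affine:
  fixes A :: "nmin^'n^'m" and B :: "nmin^'q^'m"
  assumes "continuous_on S f" "continuous_on S g"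
  shows "continuous_on S (\<lambda>x. A *v f x + B *v g x)"
  unfolding matrix_vector_mult_def plus_vec_def vec_lambda_beta
  by (intro continuous_intros assms)

lemma closed_finitely_generated:
  assumes "finitely_generated K"
  shows "closed K"
proof -
  obtain G where G: "finite G" "K = semimodule_span G"
    using assms unfolding finitely_generated_def by blast
  \<comment> \<open>The coefficients \<open>c\<close> are functions on all vectors, not only on
    \<open>G\<close>, so that the domain of \<open>h\<close> is a full product space and hence
    compact.\<close>
  define h where "h c = (\<Sum>g\<in>G. c g *s g)" for c
  have "K = range h"
  proof
    show "range h \<subseteq> K"
      unfolding G(2) semimodule_span_def h_def using G(1) by blast
    show "K \<subseteq> range h"
    proof
      fix x assume "x \<in> K"
      then obtain S c where S: "finite S" "S \<subseteq> G" "x = (\<Sum>g\<in>S. c g *s g)"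
        unfolding G(2) semimodule_span_def by blast
      \<comment> \<open>Generators outside \<open>S\<close> receive the tropical zero, that is
        infinity, and so do not affect the sum.\<close>
      have "x = h (\<lambda>g. if g \<in> S then c g else 0)"
        unfolding S(3) h_def using G(1) S(2) by (intro sum.mono_neutral_cong_left) auto
      then show "x \<in> range h" by blast
    qed
  qed
  moreover have "continuous_on UNIV h"
  proof -
    have "h = (\<lambda>c. \<chi> i. \<Sum>g\<in>G. c g * g $ i)"
      by (simp add: h_def fun_eq_iff vec_eq_iff)
    moreover have "continuous_on UNIV (\<lambda>c. \<chi> i. \<Sum>g\<in>G. c g * g $ i)"
      by (intro continuous_intros continuous_on_product_coordinates)
    ultimately show ?thesis by simp
  qed
  ultimately show ?thesis
    by (simp add: compact_imp_closed_vec compact_continuous_image compact_UNIV_fun compact_UNIV_nmin)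
qed

text \<open>Elements of \<open>matrix_image B\<close> are exactly the products
  \<open>B *v u\<close>, so the existential over the image becomes one over controls.\<close>

lemma phi_eq: "phi A B X = {x \<in> X. \<exists>u. A *v x + B *v u \<in> X}"
  by (auto simp: phi_def semimodule_ominus_def matrix_image_eq_range)

lemma closed_phi:
  fixes A :: "nmin^'n^'n" and B :: "nmin^'q^'n"
  assumes "closed X"
  shows "closed (phi A B X)"
proof -
  \<comment> \<open>Pairs of a state in \<open>X\<close> and a control leading back into
    \<open>X\<close>; the projection to the state is \<open>phi A B X\<close>.\<close>
  define P where "P = (X \<times> UNIV) \<inter> (\<lambda>(x, u). A *v x + B *v u) -` X"
  have "closed P"
    unfolding P_def case_prod_unfold
    by (intro closed_Int closed_Times closed_vimage continuous_on_matrix_vector_affine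
        continuous_intros assms closed_UNIV)
  moreover have "compact (UNIV :: ((nmin^'n) \<times> (nmin^'q)) set)"
    using compact_Times[OF compact_UNIV_vec compact_UNIV_vec, OF compact_UNIV_nmin compact_UNIV_nmin]
    by simp
  ultimately have "compact P"
    using closed_Int_compact[of P UNIV] by simp
  then have "compact (fst ` P)"
    by (intro compact_continuous_image continuous_intros)
  also have "fst ` P = phi A B X"
    by (force simp: P_def phi_eq)
  finally show ?thesis
    by (rule compact_imp_closed_vec)
qed

section \<open>Invariance, common controls and the limit of the iteration\<close>

lemma phi_mono: "X \<subseteq> Y \<Longrightarrow> phi A B X \<subseteq> phi A B Y"
  by (auto simp: phi_eq)

lemma invariant_semimodule_iff_phi:
  "invariant_semimodule A B X \<longleftrightarrow> subsemimodule X \<and> X \<subseteq> phi A B X"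
  by (auto simp: invariant_semimodule_def phi_eq)

lemma uniform_control_decreasing_closed:
  fixes A :: "nmin^'n^'n" and B :: "nmin^'q^'n" and Y :: "nat \<Rightarrow> (nmin^'n) set"
  assumes "decseq Y" "\<And>r. closed (Y r)" "\<And>r. \<exists>u. A *v x + B *v u \<in> Y r"
  shows "\<exists>u. A *v x + B *v u \<in> (\<Inter>r. Y r)"
proof -
  define F where "F r = (\<lambda>u. A *v x + B *v u) -` Y r" for r
  have "UNIV \<inter> (\<Inter>r\<in>UNIV. F r) \<noteq> {}"
  proof (rule compact_imp_fip_image)
    show "compact (UNIV :: (nmin^'q) set)"
      by (rule compact_UNIV_vec[OF compact_UNIV_nmin])
    show "closed (F r)" for r
      unfolding F_def
      by (intro closed_vimage assms continuous_on_matrix_vector_affine continuous_intros)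
    fix I :: "nat set" assume "finite I"
    \<comment> \<open>By monotonicity, the single set \<open>F m\<close> lies in every
      \<open>F r\<close> with \<open>r\<close> in \<open>I\<close>, so the finite intersection
      inherits its nonemptiness.\<close>
    then obtain m where "\<forall>r\<in>I. r \<le> m"
      using finite_nat_set_iff_bounded_le by blast
    with assms(1) have "F m \<subseteq> (\<Inter>r\<in>I. F r)"
      unfolding F_def decseq_def by blast
    moreover have "F m \<noteq> {}"
      using assms(3)[of m] by (auto simp: F_def)
    ultimately show "UNIV \<inter> (\<Inter>r\<in>I. F r) \<noteq> {}" by auto
  qed
  then show ?thesis
    by (auto simp: F_def)
qed

theorem theorem1:
  fixes K :: "(nmin^'n) set"
    and A :: "nmin^'n^'n"
    and B :: "nmin^'q^'n"
    and \<X> :: "nat \<Rightarrow> (nmin^'n) set"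
  assumes "subsemimodule K"
    and "finitely_generated K"
    and "\<X> 1 = K"
    and "\<And>r. r \<ge> 1 \<Longrightarrow> \<X> (r + 1) = phi A B (\<X> r)"
  shows "maximal_invariant_semimodule A B K (\<Inter>r\<in>{1..}. \<X> r)"
proof -
  \<comment> \<open>Reindexing from 0 suits induction and \<open>decseq\<close>; the value
    \<open>\<X> 0\<close> is unconstrained.\<close>
  define Y where "Y r = \<X> (Suc r)" for r
  have Y_0: "Y 0 = K" and Y_Suc: "Y (Suc r) = phi A B (Y r)" for r
    using assms(3) assms(4)[of "Suc r"] by (simp_all add: Y_def)
  have "{1..} = range Suc"
    unfolding One_nat_def atLeast_Suc_greaterThan greaterThan_0 ..
  then have "(\<Inter>r\<in>{1..}. \<X> r) = (\<Inter>r\<in>range Suc. \<X> r)"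
    by (rule arg_cong)
  also have "\<dots> = (\<Inter>r. Y r)"
    by (simp add: Y_def image_image)
  finally have inter: "(\<Inter>r\<in>{1..}. \<X> r) = (\<Inter>r. Y r)" .
  have dec: "decseq Y"
    by (intro decseq_SucI) (auto simp: Y_Suc phi_eq)
  have sub: "subsemimodule (Y r)" for r
    by (induction r) (simp_all add: Y_0 Y_Suc assms(1) subsemimodule_phi)
  have closed: "closed (Y r)" for r
    by (induction r) (simp_all add: Y_0 Y_Suc closed_finitely_generated assms(2) closed_phi)
  have "\<exists>u. A *v x + B *v u \<in> (\<Inter>r. Y r)" if "x \<in> (\<Inter>r. Y r)" for x
  proof (rule uniform_control_decreasing_closed[OF dec closed])
    fix r
    \<comment> \<open>Membership one index later, in \<open>Y (Suc r)\<close>, supplies a control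
      into \<open>Y r\<close>.\<close>
    have "x \<in> phi A B (Y r)"
      using that unfolding Y_Suc[symmetric] by blast
    then show "\<exists>u. A *v x + B *v u \<in> Y r"
      by (simp add: phi_eq)
  qed
  moreover have "subsemimodule (\<Inter>r. Y r)"
    using sub by (simp add: subsemimodule_def)
  \<comment> \<open>Invariant semimodules satisfy \<open>X \<subseteq> phi A B X\<close>, so
    monotonicity of \<open>phi\<close> carries the inclusion from \<open>Y r\<close> to
    \<open>Y (Suc r)\<close>.\<close>
  moreover have "X \<subseteq> Y r" if "invariant_semimodule A B X" "X \<subseteq> K" for X r
  proof (induction r)
    case (Suc r)
    then show ?case
      using that(1) phi_mono[of X "Y r" A B] by (auto simp: Y_Suc invariant_semimodule_iff_phi)
  qed (simp add: Y_0 that(2))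
  moreover have "(\<Inter>r. Y r) \<subseteq> K"
    using Y_0 by blast
  ultimately show ?thesis
    unfolding inter maximal_invariant_semimodule_def invariant_semimodule_def by blast
qed

end
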